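(* Let $\mathcal{M}=\mathcal{M}(\alpha,\omega)$ be a lattice path matroid. Then the toric ideal of $\mathcal{M}$ is generated by symmetric exchange binomials. Moreover, there exists a monomial order on the base ring of $\mathcal{M}$ under which the symmetric exchange binomials form a Gröbner basis for the toric ideal.
   Context: Fix integers $n,r>0$. A lattice path is a sequence of unit north/east steps from the origin to $(n,r)$; for such a path $\sigma$, $N(\sigma)\subseteq[n+r]$ is the set of $i$ such that the $i$-th step of $\sigma$ is north. Write $\sigma\succeq\tau$ if for every $i\le n$ the $i$-th east step of $\sigma$ lies on or above the $i$-th east step of $\tau$. For fixed lattice paths $\alpha\succeq\omega$, the lattice path matroid $\mathcal{M}(\alpha,\omega)$ is the matroid on $[n+r]$ whose bases are the sets $N(\sigma)$ with $\alpha\succeq\sigma\succeq\omega$. The base ring of $\mathcal{M}$ is $\mathbb{C}[Y_B : B\text{ a basis}]$, and its toric ideal is the kernel of the $\mathbb{C}$-algebra map to $\mathbb{C}[x_1,x_2,\ldots]$ sending $Y_B\mapsto\prod_{i\in B}x_i$. If $B,B'$ are bases, $i\in B\setminus B'$, $j\in B'\setminus B$, and both $(B\setminus\{i\})\cup\{j\}$ and $(B'\setminus\{j\})\cup\{i\}$ are bases, the latter are obtained from $B,B'$ by a symmetric exchange, and $Y_BY_{B'}-Y_{(B\setminus\{i\})\cup\{j\}}Y_{(B'\setminus\{j\})\cup\{i\}}$ is a symmetric exchange binomial. *)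

theory Defs
  imports "HOL-Algebra.Ideal" "HOL-Algebra.RingHom" "HOL-Library.Poly_Mapping" Complex_Main
begin

section \<open>Lattice paths and lattice path matroids\<close>

datatype step = North | East

definition lattice_path :: "nat \<Rightarrow> nat \<Rightarrow> step list \<Rightarrow> bool" where
  "lattice_path n r \<sigma> \<longleftrightarrow> count_list \<sigma> East = n \<and> count_list \<sigma> North = r"

text \<open>Steps are numbered from 1, whereas list positions start at 0.\<close>

definition north_set :: "step list \<Rightarrow> nat set" where
  "north_set \<sigma> = {i \<in> {1..length \<sigma>}. \<sigma> ! (i - 1) = North}"

text \<open>The \<open>i\<close>-th east step (\<open>1 \<le> i\<close>) joins \<open>(i - 1, h)\<close> to \<open>(i, h)\<close>; its height \<open>h\<close> is the number
  of north steps before it. Hence the \<open>i\<close>-th east step of one path lies on or above that of another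
  iff its height is at least as large.\<close>

definition east_position :: "step list \<Rightarrow> nat \<Rightarrow> nat" where
  "east_position \<sigma> i = filter (\<lambda>p. \<sigma> ! p = East) [0..<length \<sigma>] ! (i - 1)"

definition east_height :: "step list \<Rightarrow> nat \<Rightarrow> nat" where
  "east_height \<sigma> i = count_list (take (east_position \<sigma> i) \<sigma>) North"

definition weakly_above :: "nat \<Rightarrow> step list \<Rightarrow> step list \<Rightarrow> bool" where
  "weakly_above n \<sigma> \<tau> \<longleftrightarrow> (\<forall>i\<in>{1..n}. east_height \<tau> i \<le> east_height \<sigma> i)"

text \<open>A matroid enters the definitions below only through its set of bases, and is represented
  by it. The ground set of the lattice path matroid is \<open>{1..n + r}\<close>.\<close>

definition lattice_path_matroid :: "nat \<Rightarrow> nat \<Rightarrow> step list \<Rightarrow> step list \<Rightarrow> nat set set" where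
  "lattice_path_matroid n r \<alpha> \<omega> =
    {north_set \<sigma> | \<sigma>. lattice_path n r \<sigma> \<and> weakly_above n \<alpha> \<sigma> \<and> weakly_above n \<sigma> \<omega>}"


section \<open>Polynomial rings\<close>

text \<open>Monomials are finitely supported exponent functions, polynomials are finitely supported
  coefficient functions on monomials; \<open>keys\<close> is the support in both cases.\<close>

type_synonym 'v mono = "'v \<Rightarrow>\<^sub>0 nat"
type_synonym 'v mpoly = "'v mono \<Rightarrow>\<^sub>0 complex"

definition monomials :: "'v set \<Rightarrow> 'v mono set" where
  "monomials V = {m. Poly_Mapping.keys m \<subseteq> V}"

definition poly_ring :: "'v set \<Rightarrow> 'v mpoly ring" where
  "poly_ring V = \<lparr>carrier = {p. Poly_Mapping.keys p \<subseteq> monomials V},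
     monoid.mult = (*), one = 1, zero = 0, add = (+)\<rparr>"

definition monom :: "'v mono \<Rightarrow> 'v mpoly" where
  "monom m = Poly_Mapping.single m 1"

definition var :: "'v \<Rightarrow> 'v mpoly" where
  "var v = monom (Poly_Mapping.single v 1)"

definition const :: "complex \<Rightarrow> 'v mpoly" where
  "const c = Poly_Mapping.single 0 c"

text \<open>The \<open>\<complex>\<close>-algebra map sending each variable \<open>v\<close> to \<open>f v\<close>.\<close>

definition alg_map :: "('v \<Rightarrow> 'w mpoly) \<Rightarrow> 'v mpoly \<Rightarrow> 'w mpoly" where
  "alg_map f p = (\<Sum>m\<in>Poly_Mapping.keys p.
     const (Poly_Mapping.lookup p m) * (\<Prod>v\<in>Poly_Mapping.keys m. f v ^ Poly_Mapping.lookup m v))"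


section \<open>Monomial orders and Groebner bases\<close>

text \<open>\<open>(u, v) \<in> ord\<close> means that \<open>u\<close> is at most \<open>v\<close>.\<close>

definition monomial_order :: "'v set \<Rightarrow> 'v mono rel \<Rightarrow> bool" where
  "monomial_order V ord \<longleftrightarrow> well_order_on (monomials V) ord \<and>
    (\<forall>u v w. (u, v) \<in> ord \<longrightarrow> w \<in> monomials V \<longrightarrow> (u + w, v + w) \<in> ord)"

definition lead_monomial :: "'v mono rel \<Rightarrow> 'v mpoly \<Rightarrow> 'v mono" where
  "lead_monomial ord p =
     (THE m. m \<in> Poly_Mapping.keys p \<and> (\<forall>m'\<in>Poly_Mapping.keys p. (m', m) \<in> ord))"

text \<open>The zero polynomial has no leading monomial and is discarded.\<close>

definition initial_ideal :: "'v set \<Rightarrow> 'v mono rel \<Rightarrow> 'v mpoly set \<Rightarrow> 'v mpoly set" where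
  "initial_ideal V ord S = Idl\<^bsub>poly_ring V\<^esub> ((\<lambda>p. monom (lead_monomial ord p)) ` (S - {0}))"

definition groebner_basis :: "'v set \<Rightarrow> 'v mono rel \<Rightarrow> 'v mpoly set \<Rightarrow> 'v mpoly set \<Rightarrow> bool" where
  "groebner_basis V ord G I \<longleftrightarrow>
    finite G \<and> G \<subseteq> I \<and> initial_ideal V ord G = initial_ideal V ord I"


section \<open>Toric ideal and symmetric exchange binomials\<close>

text \<open>The base ring of a matroid with set of bases \<open>\<B>\<close> is \<open>poly_ring \<B>\<close>: the variable \<open>Y\<^sub>B\<close> is \<open>var B\<close>.
  The target of the toric map is the polynomial ring in \<open>x\<^sub>1, x\<^sub>2, \<dots>\<close>.\<close>

abbreviation base_ring :: "nat set set \<Rightarrow> nat set mpoly ring" where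
  "base_ring \<equiv> poly_ring"

definition toric_map :: "nat set mpoly \<Rightarrow> nat mpoly" where
  "toric_map = alg_map (\<lambda>B. \<Prod>i\<in>B. var i)"

definition toric_ideal :: "nat set set \<Rightarrow> nat set mpoly set" where
  "toric_ideal \<B> = a_kernel (base_ring \<B>) (poly_ring {1..}) toric_map"

definition symmetric_exchange_binomials :: "nat set set \<Rightarrow> nat set mpoly set" where
  "symmetric_exchange_binomials \<B> =
    {var B * var B' - var (B - {i} \<union> {j}) * var (B' - {j} \<union> {i}) | B B' i j.
      B \<in> \<B> \<and> B' \<in> \<B> \<and> i \<in> B - B' \<and> j \<in> B' - B \<and>
      B - {i} \<union> {j} \<in> \<B> \<and> B' - {j} \<union> {i} \<in> \<B>}"


section \<open>Well-definedness\<close>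

lemma monomials_zero: "0 \<in> monomials V"
  by (simp add: monomials_def)

lemma monomials_add: "u \<in> monomials V \<Longrightarrow> v \<in> monomials V \<Longrightarrow> u + v \<in> monomials V"
  using keys_add[of u v] by (auto simp: monomials_def)

lemma poly_ring_simps [simp]:
  "p \<in> carrier (poly_ring V) \<longleftrightarrow> Poly_Mapping.keys p \<subseteq> monomials V"
  "\<zero>\<^bsub>poly_ring V\<^esub> = 0" "\<one>\<^bsub>poly_ring V\<^esub> = 1"
  "p \<oplus>\<^bsub>poly_ring V\<^esub> q = p + q" "p \<otimes>\<^bsub>poly_ring V\<^esub> q = p * q"
  by (simp_all add: poly_ring_def)

lemma keys_mult_monomials:
  assumes "Poly_Mapping.keys p \<subseteq> monomials V" "Poly_Mapping.keys q \<subseteq> monomials V"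
  shows "Poly_Mapping.keys (p * q) \<subseteq> monomials V"
proof
  fix x assume "x \<in> Poly_Mapping.keys (p * q)"
  then obtain a b where "x = a + b" "a \<in> Poly_Mapping.keys p" "b \<in> Poly_Mapping.keys q"
    using keys_mult[of p q] by blast
  then show "x \<in> monomials V"
    using assms monomials_add[of a V b] by blast
qed

lemma keys_add_monomials:
  assumes "Poly_Mapping.keys p \<subseteq> monomials V" "Poly_Mapping.keys q \<subseteq> monomials V"
  shows "Poly_Mapping.keys (p + q) \<subseteq> monomials V"
  using assms keys_add[of p q] by blast

lemma cring_poly_ring: "cring (poly_ring V)"
proof (intro cringI abelian_groupI comm_monoidI)
  show "\<exists>q\<in>carrier (poly_ring V). q \<oplus>\<^bsub>poly_ring V\<^esub> p = \<zero>\<^bsub>poly_ring V\<^esub>"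
    if "p \<in> carrier (poly_ring V)" for p
    using that by (intro bexI[of _ "- p"]) auto
qed (simp_all add: keys_mult_monomials keys_add_monomials monomials_zero algebra_simps)

end

(* Identify a path with the height function of its set of north steps; the bases are then the
   r-subsets of {1..n + r} with heights between two bounds. Weight a base B primarily by the sum of
   the squares of its heights and secondarily by a constant minus the square of the sum of its
   heights. Let d be the difference of the heights of two bases. Unless d takes values in {0, 1} or
   in {-1, 0}, lowering d by 2 on a suitable excursion {d > 0} (or raising it on {d < 0}) is a
   symmetric exchange that decreases the weight: if |d| reaches 2 the sum of squares drops, and
   otherwise the excursion is chosen so that the two areas move apart. Hence only monomials all of whose
   pairs satisfy |d| <= 1 with constant sign are irreducible, and such a monomial is determined by
   its image under the toric map. *)

theory Submission
  imports Defs
begin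

section \<open>Heights and excursions\<close>

text \<open>Sorting a pair of bases outright may move many elements at once, whereas a symmetric
  exchange trades one element each way. A single excursion bridges this: d vanishes at both ends and
  changes by at most 1 per step, so the two ends of a maximal interval with d > 0 supply the
  exchanged elements, and the new heights stay between the old ones, hence within the bounds. If d =
  1 throughout the excursion, the two height functions merely trade places there and the sum of
  squares does not change; this is why a second weight is needed. Moving two areas apart increases
  the sum of their squares, so the square enters with a minus sign, and the constant keeps the
  weight a natural number. Both claims rest on one fact: each fibre of the monomial map contains at
  most one irreducible monomial. Rewriting stays in a fibre and terminates, so monomials of one
  fibre are congruent modulo the binomials, and the leading monomial of a kernel element cannot be
  irreducible.\<close>

definition height :: "nat set \<Rightarrow> nat \<Rightarrow> nat" where
  "height B k = card (B \<inter> {1..k})"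

lemma height_0 [simp]: "height B 0 = 0"
  by (simp add: height_def)

lemma height_Suc: "height B (Suc k) = height B k + of_bool (Suc k \<in> B)"
  by (simp add: height_def atLeastAtMostSuc_conv)

lemma height_conv_sum: "height B k = (\<Sum>i\<in>{1..k}. of_bool (i \<in> B))"
  by (induction k) (simp_all add: height_Suc)

lemma height_le_card: "finite B \<Longrightarrow> height B k \<le> card B"
  by (simp add: height_def card_mono)

lemma height_eq_card: "B \<subseteq> {1..N} \<Longrightarrow> N \<le> k \<Longrightarrow> height B k = card B"
  unfolding height_def by (rule arg_cong[of _ _ card]) auto

lemma set_eq_if_height_eq:
  assumes "0 \<notin> B" "0 \<notin> C" "height B = height C"
  shows "B = C"
proof (rule Set.set_eqI)
  fix i
  show "i \<in> B \<longleftrightarrow> i \<in> C"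
  proof (cases i)
    case (Suc k)
    then show ?thesis
      using height_Suc[of B k] height_Suc[of C k] assms(3) by (simp add: of_bool_def split: if_splits)
  qed (use assms in simp)
qed

text \<open>Written additively on both sides, so that no truncated subtraction occurs whichever of
  \<open>i\<close> and \<open>j\<close> comes first.\<close>

lemma height_swap:
  assumes "i \<in> B" "j \<notin> B" "0 < i" "0 < j"
  shows "height (B - {i} \<union> {j}) k + of_bool (i \<le> k) = height B k + of_bool (j \<le> k)"
proof (induction k)
  case (Suc k)
  then show ?case
    using assms by (auto simp: height_Suc le_Suc_eq of_bool_def split: if_splits)
qed (use assms in simp)

text \<open>The height difference is 0 at 0 and at \<open>N\<close>, so around \<open>k\<close>
  there are a last earlier and a first later point where it is not positive. It must step up right
  after the former and down at the latter, which puts \<open>i\<close> in \<open>B - B'\<close> and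
  \<open>j\<close> in \<open>B' - B\<close>.\<close>

lemma excursion:
  assumes "B \<subseteq> {1..N}" "B' \<subseteq> {1..N}" "card B = card B'" "height B' k < height B k"
  obtains i j where "i \<in> B - B'" "j \<in> B' - B" "i \<le> k" "k < j" "j \<le> N"
    "\<And>x. i \<le> x \<Longrightarrow> x < j \<Longrightarrow> height B' x < height B x"
proof -
  define Q where "Q x \<longleftrightarrow> height B x \<le> height B' x" for x
  have kN: "k < N"
    using assms height_eq_card[of B N k] height_eq_card[of B' N k] by (cases "N \<le> k") auto
  define p where "p = (GREATEST x. x \<le> k \<and> Q x)"
  have p: "p \<le> k \<and> Q p"
    unfolding p_def by (rule GreatestI_nat[where k = 0 and b = k]) (auto simp: Q_def)
  have p_max: "x \<le> p" if "x \<le> k" "Q x" for x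
    unfolding p_def using that by (intro Greatest_le_nat[where b = k]) auto
  define j where "j = (LEAST x. k < x \<and> Q x)"
  have N: "k < N \<and> Q N"
    using kN assms by (simp add: Q_def height_eq_card[of _ N])
  have j: "k < j \<and> Q j" "j \<le> N"
    unfolding j_def by (rule LeastI[of _ N], rule N) (rule Least_le, rule N)
  have j_min: "\<not> Q x" if "k < x" "x < j" for x
    using not_less_Least[of x "\<lambda>x. k < x \<and> Q x"] that by (auto simp: j_def)
  have between: "height B' x < height B x" if "Suc p \<le> x" "x < j" for x
    using p_max[of x] j_min[of x] that by (force simp: Q_def)
  have "p \<noteq> k"
    using p assms(4) by (auto simp: Q_def)
  show thesis
  proof (rule that)
    show "Suc p \<in> B - B'"
      using between[of "Suc p"] p j \<open>p \<noteq> k\<close>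
      by (auto simp: Q_def height_Suc of_bool_def split: if_splits)
    obtain l where l: "j = Suc l"
      using j by (cases j) auto
    show "j \<in> B' - B"
      using between[of l] p j \<open>p \<noteq> k\<close> l
      by (auto simp: Q_def height_Suc of_bool_def split: if_splits)
  qed (use p j \<open>p \<noteq> k\<close> between in auto)
qed

section \<open>Height-bounded families and their symmetric exchanges\<close>

definition bounded_sets :: "nat \<Rightarrow> nat \<Rightarrow> (nat \<Rightarrow> nat) \<Rightarrow> (nat \<Rightarrow> nat) \<Rightarrow> nat set set" where
  "bounded_sets N r lo hi =
    {B. B \<subseteq> {1..N} \<and> card B = r \<and> (\<forall>k. lo k \<le> height B k \<and> height B k \<le> hi k)}"

lemma finite_bounded_sets: "finite (bounded_sets N r lo hi)"
  by (rule finite_subset[of _ "Pow {1..N}"]) (auto simp: bounded_sets_def)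

definition symmetric_exchange ::
    "nat set set \<Rightarrow> nat set \<Rightarrow> nat set \<Rightarrow> nat set \<Rightarrow> nat set \<Rightarrow> bool" where
  "symmetric_exchange \<B> B B' C C' \<longleftrightarrow> {B, B', C, C'} \<subseteq> \<B> \<and>
    (\<exists>i j. i \<in> B - B' \<and> j \<in> B' - B \<and> C = B - {i} \<union> {j} \<and> C' = B' - {j} \<union> {i})"

lemma symmetric_exchange_commute:
  "symmetric_exchange \<B> B B' C C' \<longleftrightarrow> symmetric_exchange \<B> B' B C' C"
  unfolding symmetric_exchange_def by auto

lemma excursion_exchange:
  assumes B: "B \<in> bounded_sets N r lo hi" and B': "B' \<in> bounded_sets N r lo hi"
    and less: "height B' k < height B k"
  obtains C C' S where "symmetric_exchange (bounded_sets N r lo hi) B B' C C'"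
    "k \<in> S" "S \<subseteq> {..N}" "\<And>x. x \<in> S \<Longrightarrow> height B' x < height B x"
    "\<And>x. height C x + of_bool (x \<in> S) = height B x"
    "\<And>x. height C' x = height B' x + of_bool (x \<in> S)"
proof -
  note bd = B[unfolded bounded_sets_def, simplified] B'[unfolded bounded_sets_def, simplified]
  obtain i j where ij: "i \<in> B - B'" "j \<in> B' - B" "i \<le> k" "k < j" "j \<le> N"
    "\<And>x. i \<le> x \<Longrightarrow> x < j \<Longrightarrow> height B' x < height B x"
    using excursion[of B N B' k] bd less by auto
  have pos: "0 < i" "0 < j"
    using ij(1,2) bd by auto
  let ?C = "B - {i} \<union> {j}" and ?C' = "B' - {j} \<union> {i}"
  have C: "height ?C x + of_bool (x \<in> {i..<j}) = height B x" for x
    using height_swap[of i B j x] ij(1-5) pos by (auto simp: of_bool_def split: if_splits)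
  have C': "height ?C' x = height B' x + of_bool (x \<in> {i..<j})" for x
    using height_swap[of j B' i x] ij(1-5) pos by (auto simp: of_bool_def split: if_splits)
  have fin: "finite B" "finite B'"
    using bd finite_subset by blast+
  \<comment> \<open>Wherever the heights move they differ by at least 1, so a unit step of each
    towards the other stays within the old pair of values. Any bounds on the old heights therefore
    hold for the new ones.\<close>
  have between: "l \<le> c \<and> c \<le> h \<and> l \<le> c' \<and> c' \<le> h"
    if "l \<le> b" "b \<le> h" "l \<le> b'" "b' \<le> h" "P \<Longrightarrow> b' < b"
      "c + of_bool P = b" "c' = b' + of_bool P"
    for l h b b' c c' :: nat and P
    using that by (cases P) auto
  have "lo x \<le> height ?C x \<and> height ?C x \<le> hi x \<and> lo x \<le> height ?C' x \<and> height ?C' x \<le> hi x" for x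
  proof (rule between[OF _ _ _ _ _ C C'])
    show "x \<in> {i..<j} \<Longrightarrow> height B' x < height B x"
      by (rule ij(6)) simp_all
  qed (use bd in blast)+
  moreover have "card ?C = r" "card ?C' = r"
    using ij(1,2) fin bd(1)[THEN conjunct2, THEN conjunct1] bd(2)[THEN conjunct2, THEN conjunct1]
      card_Suc_Diff1[of B i] card_Suc_Diff1[of B' j] by auto
  moreover have "?C \<subseteq> {1..N}" "?C' \<subseteq> {1..N}"
    using ij(1,2) bd by auto
  ultimately have "?C \<in> bounded_sets N r lo hi" "?C' \<in> bounded_sets N r lo hi"
    unfolding bounded_sets_def by blast+
  then have "symmetric_exchange (bounded_sets N r lo hi) B B' ?C ?C'"
    unfolding symmetric_exchange_def using B B' ij(1,2) by blast
  then show thesis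
  proof (rule that[of _ _ "{i..<j}"])
    show "k \<in> {i..<j}" "{i..<j} \<subseteq> {..N}"
      using ij(3-5) by auto
    show "x \<in> {i..<j} \<Longrightarrow> height B' x < height B x" for x
      by (rule ij(6)) simp_all
  qed (rule C C')+
qed

section \<open>Exchanges that decrease the weight\<close>

definition interleaved :: "nat set \<Rightarrow> nat set \<Rightarrow> bool" where
  "interleaved B B' \<longleftrightarrow> (\<forall>k. height B' k \<le> height B k \<and> height B k \<le> height B' k + 1)"

definition square_weight :: "nat \<Rightarrow> nat set \<Rightarrow> nat" where
  "square_weight N B = (\<Sum>k\<le>N. (height B k)\<^sup>2)"

definition area :: "nat \<Rightarrow> nat set \<Rightarrow> nat" where
  "area N B = (\<Sum>k\<le>N. height B k)"

definition area_weight :: "nat \<Rightarrow> nat \<Rightarrow> nat set \<Rightarrow> nat" where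
  "area_weight N r B = ((N + 1) * r)\<^sup>2 - (area N B)\<^sup>2"

text \<open>Ensures that the subtraction in \<open>area_weight\<close> is never truncated: there are
  \<open>N + 1\<close> heights, each at most \<open>r\<close>.\<close>

lemma area_le:
  assumes "B \<in> bounded_sets N r lo hi"
  shows "area N B \<le> (N + 1) * r"
proof -
  have "height B k \<le> r" for k
    using assms height_le_card[of B k] finite_subset[of B "{1..N}"] by (auto simp: bounded_sets_def)
  then have "area N B \<le> (\<Sum>k\<le>N. r)"
    unfolding area_def by (intro sum_mono)
  then show ?thesis
    by simp
qed

text \<open>Moving two numbers one step towards each other changes the sum of squares by 2 - 2 (b -
  b'): nothing at gap 1, a strict drop at gap 2 or more.\<close>

lemma shift_squares:
  fixes b c b' c' :: nat
  assumes "b' < b" "c + 1 = b" "c' = b' + 1"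
  shows "c\<^sup>2 + c'\<^sup>2 + 2 * (b - b') = b\<^sup>2 + b'\<^sup>2 + 2"
proof -
  obtain d where "b = b' + 1 + d"
    using assms(1) by (metis less_imp_Suc_add add_Suc_right add.commute plus_1_eq_Suc)
  moreover from this have "c = b' + d"
    using assms by simp
  ultimately show ?thesis
    using assms(3) by (simp add: power2_eq_square algebra_simps)
qed

text \<open>A gap of 2 at \<open>k\<close> settles the matter through the squares, whatever the
  areas are. Otherwise the squares may tie, and the tie is broken because \<open>B\<close>, of the
  smaller or equal area, loses what \<open>B'\<close> gains.\<close>

lemma excursion_decreases_weight:
  assumes "B \<in> bounded_sets N r lo hi" "B' \<in> bounded_sets N r lo hi" "height B' k < height B k"
    "height B' k + 2 \<le> height B k \<or> area N B \<le> area N B'"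
  obtains C C' where "symmetric_exchange (bounded_sets N r lo hi) B B' C C'"
    "square_weight N C + square_weight N C' < square_weight N B + square_weight N B' \<or>
     square_weight N C + square_weight N C' = square_weight N B + square_weight N B' \<and>
     area_weight N r C + area_weight N r C' < area_weight N r B + area_weight N r B'"
proof -
  obtain C C' S where ex: "symmetric_exchange (bounded_sets N r lo hi) B B' C C'"
    and S: "k \<in> S" "S \<subseteq> {..N}" "\<And>x. x \<in> S \<Longrightarrow> height B' x < height B x"
    and C: "\<And>x. height C x + of_bool (x \<in> S) = height B x"
    and C': "\<And>x. height C' x = height B' x + of_bool (x \<in> S)"
    using excursion_exchange[OF assms(1-3)] by metis
  have pt: "(height C x)\<^sup>2 + (height C' x)\<^sup>2 + 2 * of_bool (x \<in> S) * (height B x - height B' x) =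
      (height B x)\<^sup>2 + (height B' x)\<^sup>2 + 2 * of_bool (x \<in> S)" for x
    using shift_squares[of "height B' x" "height B x" "height C x" "height C' x"] S(3)[of x]
      C[of x] C'[of x] by (cases "x \<in> S") auto
  have le: "(height C x)\<^sup>2 + (height C' x)\<^sup>2 \<le> (height B x)\<^sup>2 + (height B' x)\<^sup>2" for x
    using pt[of x] S(3)[of x] by (cases "x \<in> S") auto
  have sq: "square_weight N C + square_weight N C' \<le> square_weight N B + square_weight N B'"
    unfolding square_weight_def sum.distrib[symmetric] using le by (intro sum_mono)
  consider "square_weight N C + square_weight N C' < square_weight N B + square_weight N B'"
    | "\<not> height B' k + 2 \<le> height B k"
  proof (cases "height B' k + 2 \<le> height B k")
    case True
    then have "(height C k)\<^sup>2 + (height C' k)\<^sup>2 < (height B k)\<^sup>2 + (height B' k)\<^sup>2"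
      using pt[of k] S(1) by simp
    then have "(\<Sum>x\<le>N. (height C x)\<^sup>2 + (height C' x)\<^sup>2) < (\<Sum>x\<le>N. (height B x)\<^sup>2 + (height B' x)\<^sup>2)"
      using S(1,2) le by (intro sum_strict_mono_ex1) auto
    then show thesis
      using that(1) by (simp add: square_weight_def sum.distrib)
  qed (use that(2) in blast)
  then show thesis
  proof cases
    case 1
    then show thesis
      using that ex by blast
  next
    case 2
    then have area: "area N B \<le> area N B'"
      using assms(4) by blast
    define s where "s = (\<Sum>x\<le>N. of_bool (x \<in> S) :: nat)"
    have "s > 0"
      unfolding s_def using S(1,2) by (intro sum_pos2[of _ k]) auto
    have areas: "area N C + s = area N B" "area N C' = area N B' + s"
      unfolding area_def s_def sum.distrib[symmetric]
      by (intro sum.cong refl C C')+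
    have "(area N B)\<^sup>2 + (area N B')\<^sup>2 < (area N C)\<^sup>2 + (area N C')\<^sup>2"
    proof -
      \<comment> \<open>With x the area of \<open>C\<close>, the old areas are x + s and x + s + t,
        the new ones x and x + 2s + t; the sum of squares grows by 2st + 2ss.\<close>
      obtain t where t: "area N B' = area N C + s + t"
        using areas(1) area le_Suc_ex[of "area N B" "area N B'"] by auto
      have "s * s > 0"
        using \<open>s > 0\<close> by simp
      then show ?thesis
        unfolding areas(1)[symmetric] areas(2) t
        by (simp add: power2_eq_square algebra_simps)
    qed
    moreover have mem: "C \<in> bounded_sets N r lo hi" "C' \<in> bounded_sets N r lo hi"
      using ex by (simp_all add: symmetric_exchange_def)
    have "(area N B)\<^sup>2 \<le> ((N + 1) * r)\<^sup>2" "(area N B')\<^sup>2 \<le> ((N + 1) * r)\<^sup>2"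
      "(area N C)\<^sup>2 \<le> ((N + 1) * r)\<^sup>2" "(area N C')\<^sup>2 \<le> ((N + 1) * r)\<^sup>2"
      by (rule power_mono[OF area_le le0], rule assms mem)+
    ultimately have "area_weight N r C + area_weight N r C' < area_weight N r B + area_weight N r B'"
      unfolding area_weight_def by linarith
    then show thesis
      using that ex sq by (meson nat_less_le)
  qed
qed

text \<open>The base of larger area ought to be the upper one. If it fails to be, either it dips
  below the other somewhere, and an excursion there spreads the areas, or it exceeds the other by 2
  somewhere, where areas do not matter.\<close>

lemma exists_decreasing_exchange:
  assumes "B \<in> bounded_sets N r lo hi" "B' \<in> bounded_sets N r lo hi"
    "\<not> interleaved B B'" "\<not> interleaved B' B"
  obtains C C' where "symmetric_exchange (bounded_sets N r lo hi) B B' C C'"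
    "square_weight N C + square_weight N C' < square_weight N B + square_weight N B' \<or>
     square_weight N C + square_weight N C' = square_weight N B + square_weight N B' \<and>
     area_weight N r C + area_weight N r C' < area_weight N r B + area_weight N r B'"
proof -
  obtain k where "height B' k < height B k \<and> (height B' k + 2 \<le> height B k \<or> area N B \<le> area N B') \<or>
      height B k < height B' k \<and> (height B k + 2 \<le> height B' k \<or> area N B' \<le> area N B)"
  proof (cases "area N B \<le> area N B'")
    case True
    obtain k where "height B' k < height B k \<or> height B k + 1 < height B' k"
      using assms(4) unfolding interleaved_def by (meson not_le)
    then show thesis
      using that[of k] True by auto
  next
    case False
    obtain k where "height B k < height B' k \<or> height B' k + 1 < height B k"
      using assms(3) unfolding interleaved_def by (meson not_le)
    then show thesis
      using that[of k] False by auto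
  qed
  then show thesis
  proof
    assume "height B' k < height B k \<and> (height B' k + 2 \<le> height B k \<or> area N B \<le> area N B')"
    then show thesis
      using excursion_decreases_weight[OF assms(1,2)] that by blast
  next
    assume "height B k < height B' k \<and> (height B k + 2 \<le> height B' k \<or> area N B' \<le> area N B)"
    then obtain C C' where "symmetric_exchange (bounded_sets N r lo hi) B' B C C'"
      "square_weight N C + square_weight N C' < square_weight N B' + square_weight N B \<or>
       square_weight N C + square_weight N C' = square_weight N B' + square_weight N B \<and>
       area_weight N r C + area_weight N r C' < area_weight N r B' + area_weight N r B"
      using excursion_decreases_weight[OF assms(2,1)] by blast
    then show thesis
      using that[of C' C] symmetric_exchange_commute by (simp add: add.commute)
  qed
qed

section \<open>Lattice paths as height-bounded sets\<close>

lemma count_list_conv_filter: "count_list xs a = length (filter (\<lambda>p. xs ! p = a) [0..<length xs])"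
proof (induction xs rule: rev_induct)
  case (snoc x xs)
  have "filter (\<lambda>p. (xs @ [x]) ! p = a) [0..<length xs] = filter (\<lambda>p. xs ! p = a) [0..<length xs]"
    by (rule filter_cong) (auto simp: nth_append)
  then show ?case
    using snoc by simp
qed simp

lemma count_list_steps: "count_list \<sigma> North + count_list \<sigma> East = length \<sigma>"
proof (induction \<sigma>)
  case (Cons s \<sigma>)
  then show ?case by (cases s) auto
qed simp

lemma height_north_set: "height (north_set \<sigma>) k = count_list (take k \<sigma>) North"
proof (induction k)
  case (Suc k)
  show ?case
  proof (cases "k < length \<sigma>")
    case True
    then show ?thesis
      using Suc by (auto simp: height_Suc take_Suc_conv_app_nth north_set_def)
  next
    case False
    then have "Suc k \<notin> north_set \<sigma>"
      by (simp add: north_set_def)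
    with Suc False show ?thesis
      by (simp add: height_Suc)
  qed
qed simp

lemma north_set_subset: "north_set \<sigma> \<subseteq> {1..length \<sigma>}"
  by (auto simp: north_set_def)

lemma card_north_set: "card (north_set \<sigma>) = count_list \<sigma> North"
  using height_eq_card[OF north_set_subset order_refl] height_north_set[of \<sigma> "length \<sigma>"] by simp

section \<open>East steps and the comparison of paths\<close>

lemma east_position:
  assumes "1 \<le> i" "i \<le> count_list \<sigma> East"
  shows "east_position \<sigma> i < length \<sigma>" "\<sigma> ! east_position \<sigma> i = East"
    and "Suc (count_list (take (east_position \<sigma> i) \<sigma>) East) = i"
proof -
  define P where "P = (\<lambda>p. \<sigma> ! p = East)"
  let ?es = "filter P [0..<length \<sigma>]"
  define p where "p = east_position \<sigma> i"
  have p: "p = ?es ! (i - 1)"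
    by (simp add: p_def east_position_def P_def)
  have i: "i - 1 < length ?es"
    using assms by (simp add: count_list_conv_filter P_def)
  then have "p \<in> set ?es"
    unfolding p by (rule nth_mem)
  then show "p < length \<sigma>" "\<sigma> ! p = East"
    by (auto simp: P_def)
  have "[0..<length \<sigma>] = [0..<p] @ p # [Suc p..<length \<sigma>]"
    using \<open>p < length \<sigma>\<close> upt_add_eq_append[of 0 p "length \<sigma> - p"] by (simp add: upt_conv_Cons)
  then have es: "?es = filter P [0..<p] @ p # filter P [Suc p..<length \<sigma>]"
    using \<open>\<sigma> ! p = East\<close> by (simp add: P_def)
  \<comment> \<open>Both indices locate \<open>p\<close> in a list without repetitions, so the
    number of east steps before \<open>p\<close> is \<open>i - 1\<close>.\<close>
  have "?es ! length (filter P [0..<p]) = ?es ! (i - 1)" "length (filter P [0..<p]) < length ?es"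
    unfolding p[symmetric] by (simp_all add: es)
  then have "length (filter P [0..<p]) = i - 1"
    using i nth_eq_iff_index_eq[of ?es] by (metis distinct_filter distinct_upt)
  moreover have "filter P [0..<p] = filter (\<lambda>q. take p \<sigma> ! q = East) [0..<length (take p \<sigma>)]"
    using \<open>p < length \<sigma>\<close> by (intro filter_cong) (auto simp: P_def)
  ultimately show "Suc (count_list (take p \<sigma>) East) = i"
    using assms(1) by (simp add: count_list_conv_filter)
qed

lemma count_list_take_mono:
  assumes "k \<le> l"
  shows "count_list (take k xs) a \<le> count_list (take l xs) a"
proof -
  have "take l xs = take k xs @ take (l - k) (drop k xs)"
    using assms by (metis take_add le_add_diff_inverse)
  then show ?thesis
    by simp
qed

lemma east_position_less_iff:
  assumes "1 \<le> i" "i \<le> count_list \<sigma> East"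
  shows "east_position \<sigma> i < k \<longleftrightarrow> i \<le> count_list (take k \<sigma>) East"
proof
  note p = east_position[OF assms]
  assume "east_position \<sigma> i < k"
  then have "count_list (take (Suc (east_position \<sigma> i)) \<sigma>) East \<le> count_list (take k \<sigma>) East"
    by (intro count_list_take_mono) simp
  then show "i \<le> count_list (take k \<sigma>) East"
    using p by (simp add: take_Suc_conv_app_nth)
next
  note p = east_position[OF assms]
  assume "i \<le> count_list (take k \<sigma>) East"
  then show "east_position \<sigma> i < k"
    using count_list_take_mono[of k "east_position \<sigma> i" \<sigma> East] p by linarith
qed

text \<open>Before the \<open>i\<close>-th east step there are \<open>i - 1\<close> east steps, and
  list positions start at 0; hence the \<open>Suc\<close>.\<close>

lemma east_height_conv:
  assumes "1 \<le> i" "i \<le> count_list \<sigma> East"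
  shows "east_height \<sigma> i + i = Suc (east_position \<sigma> i)"
  using east_position[OF assms] count_list_steps[of "take (east_position \<sigma> i) \<sigma>"]
  by (simp add: east_height_def)

text \<open>A higher \<open>i\<close>-th east step is a later one. Later positions for all
  \<open>i\<close> mean fewer east steps in every prefix, and since prefixes of the two paths have
  equal length, more north steps.\<close>

lemma weakly_above_iff_height:
  assumes "lattice_path n r \<sigma>" "lattice_path n r \<tau>"
  shows "weakly_above n \<sigma> \<tau> \<longleftrightarrow> (\<forall>k. height (north_set \<tau>) k \<le> height (north_set \<sigma>) k)"
proof -
  note path = assms[unfolded lattice_path_def]
  have len: "length \<sigma> = n + r" "length \<tau> = n + r"
    using path count_list_steps[of \<sigma>] count_list_steps[of \<tau>] by auto
  let ?e = "\<lambda>\<sigma> k. count_list (take k \<sigma>) East"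
  have steps: "height (north_set \<tau>) k + ?e \<tau> k = height (north_set \<sigma>) k + ?e \<sigma> k" for k
    using count_list_steps[of "take k \<sigma>"] count_list_steps[of "take k \<tau>"]
    by (simp add: height_north_set len)
  have bound: "?e \<upsilon> k \<le> count_list \<upsilon> East" for \<upsilon> k
    by (metis count_list_append append_take_drop_id le_add1)
  have pos_less: "east_position \<upsilon> i < k \<longleftrightarrow> i \<le> ?e \<upsilon> k"
    if "\<upsilon> \<in> {\<sigma>, \<tau>}" "i \<in> {1..n}" for \<upsilon> i k
    using that path east_position_less_iff[of i \<upsilon> k] by auto
  have "weakly_above n \<sigma> \<tau> \<longleftrightarrow> (\<forall>i\<in>{1..n}. east_position \<tau> i \<le> east_position \<sigma> i)"
    unfolding weakly_above_def
  proof (intro ball_cong refl)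
    fix i assume "i \<in> {1..n}"
    then show "east_height \<tau> i \<le> east_height \<sigma> i \<longleftrightarrow> east_position \<tau> i \<le> east_position \<sigma> i"
      using east_height_conv[of i \<sigma>] east_height_conv[of i \<tau>] path by auto
  qed
  also have "\<dots> \<longleftrightarrow> (\<forall>i\<in>{1..n}. \<forall>k. east_position \<sigma> i < k \<longrightarrow> east_position \<tau> i < k)"
    by (intro ball_cong refl) (metis leI le_less_trans less_irrefl)
  also have "\<dots> \<longleftrightarrow> (\<forall>i\<in>{1..n}. \<forall>k. i \<le> ?e \<sigma> k \<longrightarrow> i \<le> ?e \<tau> k)"
    using pos_less by auto
  also have "\<dots> \<longleftrightarrow> (\<forall>k. ?e \<sigma> k \<le> ?e \<tau> k)"
  proof safe
    fix k
    assume *: "\<forall>i\<in>{1..n}. \<forall>k. i \<le> ?e \<sigma> k \<longrightarrow> i \<le> ?e \<tau> k"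
    show "?e \<sigma> k \<le> ?e \<tau> k"
    \<comment> \<open>A nonzero count of east steps is itself a valid index in
      \<open>{1..n}\<close>, at which the assumption is instantiated.\<close>
    proof (cases "?e \<sigma> k = 0")
      case False
      then show ?thesis
        using *[rule_format, of "?e \<sigma> k" k] bound[of k \<sigma>] path by simp
    qed simp
  next
    fix i k
    assume "\<forall>k. ?e \<sigma> k \<le> ?e \<tau> k" "i \<le> ?e \<sigma> k"
    then show "i \<le> ?e \<tau> k"
      using le_trans by blast
  qed
  also have "\<dots> \<longleftrightarrow> (\<forall>k. height (north_set \<tau>) k \<le> height (north_set \<sigma>) k)"
  proof (intro iff_allI)
    show "?e \<sigma> k \<le> ?e \<tau> k \<longleftrightarrow> height (north_set \<tau>) k \<le> height (north_set \<sigma>) k" for k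
      using steps[of k] by linarith
  qed
  finally show ?thesis .
qed

lemma exists_lattice_path:
  assumes "B \<subseteq> {1..n + r}" "card B = r"
  obtains \<sigma> where "lattice_path n r \<sigma>" "north_set \<sigma> = B"
proof
  let ?\<sigma> = "map (\<lambda>p. if Suc p \<in> B then North else East) [0..<n + r]"
  show B: "north_set ?\<sigma> = B"
  proof (rule Set.set_eqI)
    show "i \<in> north_set ?\<sigma> \<longleftrightarrow> i \<in> B" for i
      using assms(1) by (cases i) (auto simp: north_set_def split: if_splits)
  qed
  show "lattice_path n r ?\<sigma>"
    using card_north_set[of ?\<sigma>] count_list_steps[of ?\<sigma>] assms(2) B by (simp add: lattice_path_def)
qed

lemma lattice_path_matroid_eq:
  assumes "lattice_path n r \<alpha>" "lattice_path n r \<omega>"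
  shows "lattice_path_matroid n r \<alpha> \<omega> =
    bounded_sets (n + r) r (height (north_set \<omega>)) (height (north_set \<alpha>))"
proof -
  have *: "north_set \<sigma> \<in> bounded_sets (n + r) r (height (north_set \<omega>)) (height (north_set \<alpha>)) \<longleftrightarrow>
      weakly_above n \<alpha> \<sigma> \<and> weakly_above n \<sigma> \<omega>" if "lattice_path n r \<sigma>" for \<sigma>
    using that weakly_above_iff_height[OF assms(1) that] weakly_above_iff_height[OF that assms(2)]
      card_north_set[of \<sigma>] north_set_subset[of \<sigma>] count_list_steps[of \<sigma>]
    by (auto simp: bounded_sets_def lattice_path_def add.commute)
  show ?thesis
  proof (intro equalityI subsetI)
    fix B assume B: "B \<in> bounded_sets (n + r) r (height (north_set \<omega>)) (height (north_set \<alpha>))"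
    then obtain \<sigma> where "lattice_path n r \<sigma>" "north_set \<sigma> = B"
      using exists_lattice_path[of B n r] by (auto simp: bounded_sets_def)
    then show "B \<in> lattice_path_matroid n r \<alpha> \<omega>"
      using * B unfolding lattice_path_matroid_def by blast
  qed (use * in \<open>auto simp: lattice_path_matroid_def\<close>)
qed

section \<open>Weights, weight orders and monomial maps\<close>

definition weight :: "('v \<Rightarrow> nat) \<Rightarrow> 'v mono \<Rightarrow> nat" where
  "weight f m = (\<Sum>v\<in>Poly_Mapping.keys m. Poly_Mapping.lookup m v * f v)"

lemma weight_0 [simp]: "weight f 0 = 0"
  by (simp add: weight_def)

lemma weight_add [simp]: "weight f (u + v) = weight f u + weight f v"
  unfolding weight_def by (rule setsum_keys_plus_distrib) (simp_all add: algebra_simps)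

lemma weight_single [simp]: "weight f (Poly_Mapping.single v k) = k * f v"
  by (simp add: weight_def)

lemma weight_indicator: "weight (\<lambda>v. of_bool (v = w)) m = Poly_Mapping.lookup m w"
  by (simp add: weight_def in_keys_iff of_bool_def if_distrib[of "times _"] sum.delta cong: if_cong)

lemma weight_cong:
  "(\<And>v. v \<in> Poly_Mapping.keys m \<Longrightarrow> f v = g v) \<Longrightarrow> weight f m = weight g m"
  by (simp add: weight_def)

lemma weight_mono:
  "(\<And>v. v \<in> Poly_Mapping.keys m \<Longrightarrow> f v \<le> g v) \<Longrightarrow> weight f m \<le> weight g m"
  unfolding weight_def by (intro sum_mono mult_le_mono2)

lemma weight_strict_mono:
  assumes "\<And>v. v \<in> Poly_Mapping.keys m \<Longrightarrow> f v \<le> g v" "w \<in> Poly_Mapping.keys m" "f w < g w"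
  shows "weight f m < weight g m"
  unfolding weight_def
proof (rule sum_strict_mono_ex1)
  show "\<exists>v\<in>Poly_Mapping.keys m. Poly_Mapping.lookup m v * f v < Poly_Mapping.lookup m v * g v"
    using assms(2,3) by (intro bexI[of _ w]) (auto simp: in_keys_iff)
qed (use assms(1) in \<open>auto intro: mult_le_mono2\<close>)

lemma weight_const: "weight (\<lambda>_. c) m = c * weight (\<lambda>_. 1) m"
  by (simp add: weight_def sum_distrib_left mult.commute)

lemma weight_fun_add: "weight (\<lambda>v. f v + g v) m = weight f m + weight g m"
  by (simp add: weight_def sum.distrib algebra_simps)

lemma weight_fun_sum: "weight (\<lambda>v. \<Sum>i\<in>I. f i v) m = (\<Sum>i\<in>I. weight (f i) m)"
  unfolding weight_def sum_distrib_left by (rule sum.swap)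

lemma mono_split_var:
  fixes m :: "'v mono"
  assumes "v \<in> Poly_Mapping.keys m"
  obtains m' where "m = m' + Poly_Mapping.single v 1" "Poly_Mapping.keys m' \<subseteq> Poly_Mapping.keys m"
proof
  let ?m' = "m - Poly_Mapping.single v 1"
  show "m = ?m' + Poly_Mapping.single v 1"
    using assms by (intro poly_mapping_eqI)
      (auto simp: lookup_add lookup_minus lookup_single when_def in_keys_iff)
  show "Poly_Mapping.keys ?m' \<subseteq> Poly_Mapping.keys m"
    by (auto simp: in_keys_iff lookup_minus)
qed

text \<open>All weight lists have the length of \<open>ws\<close>, so \<open>lenlex\<close> compares
  them lexicographically while remaining well-founded.\<close>

definition weight_order :: "'v set \<Rightarrow> ('v \<Rightarrow> nat) list \<Rightarrow> 'v mono rel" where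
  "weight_order V ws = {(u, v). u \<in> monomials V \<and> v \<in> monomials V \<and>
    (u = v \<or> (map (\<lambda>f. weight f u) ws, map (\<lambda>f. weight f v) ws) \<in> lenlex less_than)}"

lemma lenlex_weights_add:
  "(map (\<lambda>f. weight f (u + w)) ws, map (\<lambda>f. weight f (v + w)) ws) \<in> lenlex less_than \<longleftrightarrow>
   (map (\<lambda>f. weight f u) ws, map (\<lambda>f. weight f v) ws) \<in> lenlex less_than"
  by (induction ws) (auto simp: Cons_lenlex_iff)

text \<open>The indicator weights recover every exponent, so monomials with equal weight lists
  coincide; this gives totality. Well-foundedness is pulled back from \<open>lenlex\<close>, and
  compatibility holds because adding \<open>w\<close> shifts all weight lists by the same
  vector.\<close>

lemma monomial_order_weight_order:
  assumes "\<And>v. v \<in> V \<Longrightarrow> (\<lambda>w. of_bool (w = v)) \<in> set ws"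
  shows "monomial_order V (weight_order V ws)"
proof -
  define ws_of where "ws_of u = map (\<lambda>f. weight f u) ws" for u :: "'a mono"
  have ord: "(u, v) \<in> weight_order V ws \<longleftrightarrow> u \<in> monomials V \<and> v \<in> monomials V \<and>
      (u = v \<or> (ws_of u, ws_of v) \<in> lenlex less_than)" for u v
    by (simp add: weight_order_def ws_of_def)
  have inj: "u = v" if "u \<in> monomials V" "v \<in> monomials V" "ws_of u = ws_of v" for u v
  proof (rule poly_mapping_eqI)
    fix x
    show "Poly_Mapping.lookup u x = Poly_Mapping.lookup v x"
    proof (cases "x \<in> V")
      case True
      then show ?thesis
        using assms[OF True] that(3) weight_indicator[of x u] weight_indicator[of x v]
        by (simp add: ws_of_def)
    next
      case False
      then show ?thesis
        using that(1,2) by (metis in_keys_iff monomials_def mem_Collect_eq subsetD)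
    qed
  qed
  have irrefl: "(xs, xs) \<notin> lenlex less_than" for xs
    by (simp add: lenlex_irreflexive)
  have trans: "trans (lenlex less_than)"
    by blast
  have "refl_on (monomials V) (weight_order V ws)"
    by (simp add: refl_on_def ord)
  moreover have "weight_order V ws \<subseteq> monomials V \<times> monomials V"
    by (auto simp: weight_order_def)
  moreover have "Relation.trans (weight_order V ws)"
    by (rule transI) (use trans in \<open>auto simp: ord dest: transD\<close>)
  moreover have "antisym (weight_order V ws)"
    by (rule antisymI) (use trans irrefl in \<open>auto simp: ord dest: transD\<close>)
  moreover have "total_on (monomials V) (weight_order V ws)"
    using total_lenlex[OF total_less_than] inj by (auto simp: total_on_def ord)
  moreover have "wf (weight_order V ws - Id)"
    by (rule wf_subset[OF wf_inv_image[OF wf_lenlex[OF wf_less_than], of ws_of]])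
      (auto simp: ord inv_image_def)
  ultimately have "well_order_on (monomials V) (weight_order V ws)"
    by (simp add: order_on_defs)
  moreover have "(u + w, v + w) \<in> weight_order V ws"
    if "(u, v) \<in> weight_order V ws" "w \<in> monomials V" for u v w
    using that unfolding weight_order_def by (auto intro: monomials_add simp: lenlex_weights_add simp del: weight_add)
  ultimately show ?thesis
    by (simp add: monomial_order_def)
qed

section \<open>Algebra maps that send variables to monomials\<close>

lemma monom_mult [simp]: "monom u * monom v = monom (u + v)"
  by (simp add: monom_def mult_single)

lemma monom_0: "monom 0 = 1"
  by (simp add: monom_def)

lemma const_mult_monom: "const c * monom m = Poly_Mapping.single m c"
  by (simp add: const_def monom_def mult_single)

lemma prod_monom: "(\<Prod>i\<in>A. monom (f i)) = monom (\<Sum>i\<in>A. f i)"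
  by (induction A rule: infinite_finite_induct) (simp_all add: monom_0)

lemma monom_power: "monom u ^ k = monom (\<Sum>_<k. u)"
  by (induction k) (simp_all add: monom_0 add.commute)

lemma keys_monom [simp]: "Poly_Mapping.keys (monom m) = {m}"
  by (simp add: monom_def)

text \<open>The additive extension of \<open>g\<close> to exponent vectors; the inner sum is a
  multiple of \<open>g v\<close>, in the shape produced by \<open>monom_power\<close>.\<close>

definition mono_map :: "('v \<Rightarrow> 'w mono) \<Rightarrow> 'v mono \<Rightarrow> 'w mono" where
  "mono_map g m = (\<Sum>v\<in>Poly_Mapping.keys m. \<Sum>_<Poly_Mapping.lookup m v. g v)"

lemma mono_map_0 [simp]: "mono_map g 0 = 0"
  by (simp add: mono_map_def)

lemma lookup_mono_map:
  "Poly_Mapping.lookup (mono_map g m) i = weight (\<lambda>v. Poly_Mapping.lookup (g v) i) m"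
  by (simp add: mono_map_def weight_def lookup_sum)

lemma mono_map_add: "mono_map g (u + v) = mono_map g u + mono_map g v"
  by (rule poly_mapping_eqI) (simp add: lookup_mono_map lookup_add)

lemma mono_map_single: "mono_map g (Poly_Mapping.single v 1) = g v"
  by (simp add: mono_map_def)

lemma mono_map_in_monomials:
  assumes "m \<in> monomials V" "\<And>v. v \<in> V \<Longrightarrow> g v \<in> monomials W"
  shows "mono_map g m \<in> monomials W"
proof -
  have closed: "(\<Sum>a\<in>A. f a) \<in> monomials W" if "\<And>a. a \<in> A \<Longrightarrow> f a \<in> monomials W"
    for A :: "_ set" and f
    using that by (induction A rule: infinite_finite_induct) (auto simp: monomials_zero monomials_add)
  have closed': "(\<Sum>_<k. f) \<in> monomials W" if "f \<in> monomials W" for k :: nat and f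
    using that by (induction k) (auto simp: monomials_zero monomials_add)
  show ?thesis
    unfolding mono_map_def
    by (intro closed closed' assms(2)) (use assms(1) in \<open>auto simp: monomials_def\<close>)
qed

lemma alg_map_monom:
  "alg_map (\<lambda>v. monom (g v)) p =
    (\<Sum>m\<in>Poly_Mapping.keys p. Poly_Mapping.single (mono_map g m) (Poly_Mapping.lookup p m))"
  by (simp add: alg_map_def mono_map_def monom_power prod_monom const_mult_monom)

lemma alg_map_monom_monom [simp]: "alg_map (\<lambda>v. monom (g v)) (monom m) = monom (mono_map g m)"
  by (simp add: alg_map_monom) (simp add: monom_def)

lemma alg_map_monom_single:
  "alg_map (\<lambda>v. monom (g v)) (Poly_Mapping.single m c) = Poly_Mapping.single (mono_map g m) c"
  by (simp add: alg_map_monom)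

lemma alg_map_monom_0 [simp]: "alg_map (\<lambda>v. monom (g v)) 0 = 0"
  by (simp add: alg_map_monom)

lemma alg_map_monom_add:
  "alg_map (\<lambda>v. monom (g v)) (p + q) = alg_map (\<lambda>v. monom (g v)) p + alg_map (\<lambda>v. monom (g v)) q"
  unfolding alg_map_monom by (rule setsum_keys_plus_distrib) (simp_all add: single_add)

lemma alg_map_monom_diff:
  "alg_map (\<lambda>v. monom (g v)) (p - q) = alg_map (\<lambda>v. monom (g v)) p - alg_map (\<lambda>v. monom (g v)) q"
  using alg_map_monom_add[of g "p - q" q] by (simp add: algebra_simps)

lemma poly_mapping_plus_induct [case_names zero single plus]:
  fixes p :: "'a \<Rightarrow>\<^sub>0 'b::comm_monoid_add"
  assumes "P 0" "\<And>k c. P (Poly_Mapping.single k c)" "\<And>p q. P p \<Longrightarrow> P q \<Longrightarrow> P (p + q)"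
  shows "P p"
proof -
  have "P (\<Sum>k\<in>A. Poly_Mapping.single k (f k))" for A f
    by (induction A rule: infinite_finite_induct) (simp_all add: assms)
  moreover have "p = (\<Sum>k\<in>Poly_Mapping.keys p. Poly_Mapping.single k (Poly_Mapping.lookup p k))"
    by (rule poly_mapping_eqI) (auto simp: lookup_sum lookup_single when_def in_keys_iff)
  ultimately show ?thesis
    by metis
qed

lemma alg_map_monom_mult:
  "alg_map (\<lambda>v. monom (g v)) (p * q) = alg_map (\<lambda>v. monom (g v)) p * alg_map (\<lambda>v. monom (g v)) q"
proof (induction p rule: poly_mapping_plus_induct)
  case (single k c)
  show ?case
    by (induction q rule: poly_mapping_plus_induct)
      (simp_all add: mult_single alg_map_monom_single mono_map_add algebra_simps alg_map_monom_add)
qed (simp_all add: algebra_simps alg_map_monom_add)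

lemma keys_alg_map_monom:
  "Poly_Mapping.keys (alg_map (\<lambda>v. monom (g v)) p) \<subseteq> mono_map g ` Poly_Mapping.keys p"
  unfolding alg_map_monom using keys_sum[of "\<lambda>m. Poly_Mapping.single (mono_map g m) (Poly_Mapping.lookup p m)"]
  by (auto split: if_splits)

lemma lookup_alg_map_monom:
  "Poly_Mapping.lookup (alg_map (\<lambda>v. monom (g v)) p) t =
    (\<Sum>m\<in>{m \<in> Poly_Mapping.keys p. mono_map g m = t}. Poly_Mapping.lookup p m)"
  by (simp add: alg_map_monom lookup_sum lookup_single when_def sum.inter_filter)

section \<open>Kernels of monomial maps with unique normal forms\<close>

lemma ideal_poly_ringD:
  assumes "ideal J (poly_ring V)"
  shows "0 \<in> J"
    and "p \<in> J \<Longrightarrow> q \<in> J \<Longrightarrow> p + q \<in> J"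
    and "p \<in> J \<Longrightarrow> Poly_Mapping.keys q \<subseteq> monomials V \<Longrightarrow> q * p \<in> J"
    and "p \<in> J \<Longrightarrow> q \<in> J \<Longrightarrow> p - q \<in> J"
proof -
  interpret ideal J "poly_ring V"
    by (rule assms)
  show "0 \<in> J"
    using additive_subgroup.zero_closed[OF is_additive_subgroup] by simp
  show add: "p + q \<in> J" if "p \<in> J" "q \<in> J" for p q
    using additive_subgroup.a_closed[OF is_additive_subgroup that] by simp
  show mult: "q * p \<in> J" if "p \<in> J" "Poly_Mapping.keys q \<subseteq> monomials V" for p q
    using I_l_closed[of p q] that by simp
  show "p - q \<in> J" if "p \<in> J" "q \<in> J"
    using add[OF that(1) mult[OF that(2), of "- 1"]] by (simp add: monomials_zero)
qed

section \<open>Leading monomials and rewriting\<close>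

lemma lead_monomial_eqI:
  assumes "antisym ord" "m \<in> Poly_Mapping.keys p" "\<And>m'. m' \<in> Poly_Mapping.keys p \<Longrightarrow> (m', m) \<in> ord"
  shows "lead_monomial ord p = m"
  unfolding lead_monomial_def
  by (rule the_equality) (use assms in \<open>auto dest: antisymD\<close>)

lemma exists_max_linear_order:
  assumes "linear_order_on A ord" "finite K" "K \<noteq> {}" "K \<subseteq> A"
  shows "\<exists>m\<in>K. \<forall>m'\<in>K. (m', m) \<in> ord"
  using assms(2-4)
proof (induction K rule: finite_ne_induct)
  case (singleton x)
  then show ?case
    using assms(1) by (auto simp: order_on_defs refl_on_def)
next
  case (insert x K)
  then obtain m where m: "m \<in> K" "\<forall>m'\<in>K. (m', m) \<in> ord"
    by auto
  have *: "(x, x) \<in> ord" "(x, m) \<in> ord \<or> (m, x) \<in> ord" "trans ord"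
    using assms(1) insert.prems m(1) unfolding order_on_defs total_on_def refl_on_def
    by (cases "x = m"; auto)+
  then show ?case
    using m by (metis insert_iff transD)
qed

lemma lead_monomial:
  assumes "monomial_order V ord" "p \<noteq> 0" "Poly_Mapping.keys p \<subseteq> monomials V"
  shows "lead_monomial ord p \<in> Poly_Mapping.keys p"
    and "m \<in> Poly_Mapping.keys p \<Longrightarrow> (m, lead_monomial ord p) \<in> ord"
proof -
  have lin: "linear_order_on (monomials V) ord"
    using assms(1) by (simp add: monomial_order_def order_on_defs)
  then obtain l where l: "l \<in> Poly_Mapping.keys p" "\<forall>m'\<in>Poly_Mapping.keys p. (m', l) \<in> ord"
    using exists_max_linear_order[of "monomials V" ord "Poly_Mapping.keys p"] assms(2,3) by auto
  then have "lead_monomial ord p = l"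
    using lin by (intro lead_monomial_eqI) (auto simp: order_on_defs)
  with l show "lead_monomial ord p \<in> Poly_Mapping.keys p"
    "m \<in> Poly_Mapping.keys p \<Longrightarrow> (m, lead_monomial ord p) \<in> ord"
    by auto
qed

lemma keys_monom_diff: "u \<noteq> v \<Longrightarrow> Poly_Mapping.keys (monom u - monom v) = {u, v}"
  by (auto simp: in_keys_iff lookup_minus monom_def lookup_single when_def split: if_splits)

text \<open>Divisibility by the leading monomial \<open>a\<close> of a binomial in \<open>G\<close>,
  which permits the rewriting step from \<open>a + w\<close> to \<open>b + w\<close>.\<close>

definition reducible :: "'v set \<Rightarrow> 'v mono rel \<Rightarrow> 'v mpoly set \<Rightarrow> 'v mono \<Rightarrow> bool" where
  "reducible V ord G m \<longleftrightarrow> (\<exists>a b w. monom a - monom b \<in> G \<and> a \<noteq> b \<and> (b, a) \<in> ord \<and>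
    w \<in> monomials V \<and> m = a + w)"

definition toric_kernel :: "'v set \<Rightarrow> ('v \<Rightarrow> 'w mono) \<Rightarrow> 'v mpoly set" where
  "toric_kernel V g =
    {p. Poly_Mapping.keys p \<subseteq> monomials V \<and> alg_map (\<lambda>v. monom (g v)) p = 0}"

lemma monom_diff_in_toric_kernel:
  assumes "u \<in> monomials V" "v \<in> monomials V" "mono_map g u = mono_map g v"
  shows "monom u - monom v \<in> toric_kernel V g"
proof -
  have "Poly_Mapping.keys (monom u - monom v) \<subseteq> monomials V"
    using keys_diff[of "monom u" "monom v"] assms(1,2) by auto
  moreover have "alg_map (\<lambda>v. monom (g v)) (monom u - monom v) = 0"
    using assms(3) by (simp add: alg_map_monom_diff)
  ultimately show ?thesis
    by (simp add: toric_kernel_def)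
qed

text \<open>The coefficient of an image monomial is the sum of the coefficients over its fibre; a
  lone nonzero coefficient could not cancel.\<close>

lemma exists_other_monomial_in_fiber:
  assumes "p \<in> toric_kernel V g" "m \<in> Poly_Mapping.keys p"
  obtains m' where "m' \<in> Poly_Mapping.keys p" "m' \<noteq> m" "mono_map g m' = mono_map g m"
proof (rule ccontr)
  assume "\<not> thesis"
  then have "{m' \<in> Poly_Mapping.keys p. mono_map g m' = mono_map g m} = {m}"
    using that assms(2) by auto
  then have "Poly_Mapping.lookup p m = 0"
    using lookup_alg_map_monom[of g p "mono_map g m"] assms(1) by (simp add: toric_kernel_def)
  then show False
    using assms(2) by (simp add: in_keys_iff)
qed

text \<open>Isolates what the algebra needs from the combinatorics: \<open>unique\<close> leaves at
  most one irreducible monomial in each fibre.\<close>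

locale unique_normal_forms =
  fixes V :: "'v set" and ord :: "'v mono rel" and g :: "'v \<Rightarrow> 'w mono" and G :: "'v mpoly set"
  assumes order: "monomial_order V ord"
    and ideal_kernel: "ideal (toric_kernel V g) (poly_ring V)"
    and gens: "G \<subseteq> toric_kernel V g"
    and unique: "\<lbrakk>u \<in> monomials V; v \<in> monomials V; mono_map g u = mono_map g v;
      \<not> reducible V ord G u; \<not> reducible V ord G v\<rbrakk> \<Longrightarrow> u = v"
begin

lemma order_facts: "antisym ord" "trans ord" "ord \<subseteq> monomials V \<times> monomials V"
    "refl_on (monomials V) ord" "wf (ord - Id)"
  using order by (auto simp: monomial_order_def order_on_defs)

lemma ring: "Ring.ring (poly_ring V)"
  using cring_poly_ring cring.axioms(1) by blast

lemma gens_carrier: "G \<subseteq> carrier (poly_ring V)"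
  using gens by (auto simp: toric_kernel_def)

lemma ideal_gens: "ideal (Idl\<^bsub>poly_ring V\<^esub> G) (poly_ring V)"
  by (rule ring.genideal_ideal[OF ring gens_carrier])

text \<open>Each rewriting step lowers the monomial in a well-order. It stays in the fibre because
  the binomial lies in the kernel, and it changes the monomial by a multiple of that
  binomial.\<close>

lemma exists_normal_form:
  assumes "m \<in> monomials V"
  shows "\<exists>u. u \<in> monomials V \<and> (u, m) \<in> ord \<and> mono_map g u = mono_map g m \<and>
    \<not> reducible V ord G u \<and> monom m - monom u \<in> Idl\<^bsub>poly_ring V\<^esub> G"
  using order_facts(5) assms
proof (induction m rule: wf_induct_rule)
  case (less m)
  show ?case
  proof (cases "reducible V ord G m")
    case False
    then show ?thesis
      using less.prems order_facts(4) ideal_poly_ringD(1)[OF ideal_gens]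
      by (intro exI[of _ m]) (auto simp: refl_on_def)
  next
    case True
    then obtain a b w where red: "monom a - monom b \<in> G" "a \<noteq> b" "(b, a) \<in> ord"
      "w \<in> monomials V" "m = a + w"
      by (auto simp: reducible_def)
    let ?m' = "b + w"
    have m': "(?m', m) \<in> ord"
      using order red(3-5) by (simp add: monomial_order_def)
    have "alg_map (\<lambda>v. monom (g v)) (monom a - monom b) = 0"
      using gens red(1) by (auto simp: toric_kernel_def)
    then have "monom (mono_map g a) = (monom (mono_map g b) :: 'w mpoly)"
      by (simp add: alg_map_monom_diff)
    then have "mono_map g a = mono_map g b"
      by (metis keys_monom singleton_inject)
    then have fiber: "mono_map g ?m' = mono_map g m"
      by (simp add: red(5) mono_map_add)
    have "monom w * (monom a - monom b) \<in> Idl\<^bsub>poly_ring V\<^esub> G"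
      using ring.genideal_self[OF ring gens_carrier] red(1,4)
      by (intro ideal_poly_ringD(3)[OF ideal_gens]) auto
    then have diff: "monom m - monom ?m' \<in> Idl\<^bsub>poly_ring V\<^esub> G"
      by (simp add: red(5) algebra_simps)
    have "(?m', m) \<in> ord - Id" "?m' \<in> monomials V"
      using m' red(2,5) order_facts(3) by auto
    then obtain u where u: "u \<in> monomials V" "(u, ?m') \<in> ord" "mono_map g u = mono_map g ?m'"
      "\<not> reducible V ord G u" "monom ?m' - monom u \<in> Idl\<^bsub>poly_ring V\<^esub> G"
      using less.IH by blast
    have "monom m - monom u \<in> Idl\<^bsub>poly_ring V\<^esub> G"
      using ideal_poly_ringD(2)[OF ideal_gens diff u(5)] by simp
    then show ?thesis
      using u m' fiber order_facts(2) by (metis transD)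
  qed
qed

lemma fiber_congruent:
  assumes "u \<in> monomials V" "v \<in> monomials V" "mono_map g u = mono_map g v"
  shows "monom u - monom v \<in> Idl\<^bsub>poly_ring V\<^esub> G"
proof -
  obtain u' v' where "u' \<in> monomials V" "mono_map g u' = mono_map g u" "\<not> reducible V ord G u'"
    "v' \<in> monomials V" "mono_map g v' = mono_map g v" "\<not> reducible V ord G v'"
    and diffs: "monom u - monom u' \<in> Idl\<^bsub>poly_ring V\<^esub> G" "monom v - monom v' \<in> Idl\<^bsub>poly_ring V\<^esub> G"
    using exists_normal_form[OF assms(1)] exists_normal_form[OF assms(2)] by blast
  then have "u' = v'"
    using unique assms(3) by metis
  then show ?thesis
    using ideal_poly_ringD(4)[OF ideal_gens diffs] by simp
qed

lemma toric_kernel_subset_genideal: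
  "p \<in> toric_kernel V g \<Longrightarrow> p \<in> Idl\<^bsub>poly_ring V\<^esub> G"
proof (induction "card (Poly_Mapping.keys p)" arbitrary: p rule: less_induct)
  case less
  show ?case
  proof (cases "p = 0")
    case True
    then show ?thesis
      using ideal_poly_ringD(1)[OF ideal_gens] by simp
  next
    case False
    then obtain m where m: "m \<in> Poly_Mapping.keys p"
      by fastforce
    obtain m' where m': "m' \<in> Poly_Mapping.keys p" "m' \<noteq> m" "mono_map g m' = mono_map g m"
      using exists_other_monomial_in_fiber[OF less.prems m] .
    have V: "m \<in> monomials V" "m' \<in> monomials V"
      using less.prems m m'(1) by (auto simp: toric_kernel_def)
    \<comment> \<open>Subtracting \<open>c\<close> removes \<open>m\<close> and affects otherwise
      only the coefficient of \<open>m'\<close>, which is already in the support; so the support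
      shrinks.\<close>
    define c where "c = Poly_Mapping.single 0 (Poly_Mapping.lookup p m) * (monom m - monom m')"
    have c: "c = Poly_Mapping.single m (Poly_Mapping.lookup p m) - Poly_Mapping.single m' (Poly_Mapping.lookup p m)"
      by (simp add: c_def monom_def mult_single right_diff_distrib)
    have const: "Poly_Mapping.keys (Poly_Mapping.single 0 (Poly_Mapping.lookup p m)) \<subseteq> monomials V"
      by (simp add: monomials_zero)
    have c_in: "c \<in> Idl\<^bsub>poly_ring V\<^esub> G" "c \<in> toric_kernel V g"
      unfolding c_def using V m'(3)
      by (intro ideal_poly_ringD(3)[OF ideal_gens _ const] ideal_poly_ringD(3)[OF ideal_kernel _ const]
        fiber_congruent monom_diff_in_toric_kernel; simp)+
    have "Poly_Mapping.keys (p - c) \<subseteq> Poly_Mapping.keys p - {m}"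
      using m m'(1,2)
      by (auto simp: c in_keys_iff lookup_minus lookup_single when_def split: if_splits)
    then have "card (Poly_Mapping.keys (p - c)) < card (Poly_Mapping.keys p)"
      using m by (intro psubset_card_mono) auto
    then have "p - c \<in> Idl\<^bsub>poly_ring V\<^esub> G"
      using less.hyps ideal_poly_ringD(4)[OF ideal_kernel less.prems c_in(2)] by blast
    from ideal_poly_ringD(2)[OF ideal_gens this c_in(1)] show ?thesis
      by simp
  qed
qed

theorem toric_kernel_eq_genideal: "toric_kernel V g = Idl\<^bsub>poly_ring V\<^esub> G"
  using toric_kernel_subset_genideal ring.genideal_minimal[OF ring ideal_kernel gens] by blast

text \<open>Another monomial of \<open>p\<close> in the fibre of the leading one has a normal form
  below itself. Were the leading monomial irreducible, it would be that normal form and hence lie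
  below a smaller monomial.\<close>

lemma lead_monomial_reducible:
  assumes p: "p \<in> toric_kernel V g" "p \<noteq> 0"
  shows "reducible V ord G (lead_monomial ord p)"
proof (rule ccontr)
  assume irred: "\<not> reducible V ord G (lead_monomial ord p)"
  have keys: "Poly_Mapping.keys p \<subseteq> monomials V"
    using p(1) by (simp add: toric_kernel_def)
  note lead = lead_monomial[OF order p(2) keys]
  obtain m where m: "m \<in> Poly_Mapping.keys p" "m \<noteq> lead_monomial ord p"
    "mono_map g m = mono_map g (lead_monomial ord p)"
    using exists_other_monomial_in_fiber[OF p(1) lead(1)] .
  then obtain u where u: "u \<in> monomials V" "(u, m) \<in> ord" "mono_map g u = mono_map g m"
    "\<not> reducible V ord G u"
    using exists_normal_form keys by blast
  then have "u = lead_monomial ord p"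
    using unique irred lead(1) keys m(3) by (metis subsetD)
  then show False
    using u(2) lead(2)[OF m(1)] m(2) order_facts(1) by (auto dest: antisymD)
qed

theorem groebner_basis_toric_kernel:
  assumes "finite G"
  shows "groebner_basis V ord G (toric_kernel V g)"
proof -
  let ?in = "\<lambda>S. (\<lambda>p. monom (lead_monomial ord p)) ` (S - {0})"
  have in_carrier: "?in S \<subseteq> carrier (poly_ring V)" if "S \<subseteq> toric_kernel V g" for S
  proof
    fix q assume "q \<in> ?in S"
    then obtain p where p: "p \<in> S" "p \<noteq> 0" "q = monom (lead_monomial ord p)"
      by blast
    then have keys: "Poly_Mapping.keys p \<subseteq> monomials V"
      using that unfolding toric_kernel_def by blast
    show "q \<in> carrier (poly_ring V)"
      using lead_monomial(1)[OF order p(2) keys] keys p(3) by auto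
  qed
  have ideals: "ideal (initial_ideal V ord S) (poly_ring V)"
    and self: "?in S \<subseteq> initial_ideal V ord S" if "S \<subseteq> toric_kernel V g" for S
    unfolding initial_ideal_def
    by (rule ring.genideal_ideal[OF ring in_carrier[OF that]]
      ring.genideal_self[OF ring in_carrier[OF that]])+
  have "?in (toric_kernel V g) \<subseteq> initial_ideal V ord G"
  proof
    fix q assume "q \<in> ?in (toric_kernel V g)"
    then obtain p where p: "p \<in> toric_kernel V g" "p \<noteq> 0" "q = monom (lead_monomial ord p)"
      by auto
    then obtain a b w where red: "monom a - monom b \<in> G" "a \<noteq> b" "(b, a) \<in> ord"
      "w \<in> monomials V" "lead_monomial ord p = a + w"
      using lead_monomial_reducible[OF p(1,2)] unfolding reducible_def by blast
    have keys: "Poly_Mapping.keys (monom a - monom b) = {a, b}"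
      using red(2) by (rule keys_monom_diff)
    have "(a, a) \<in> ord"
      using red(3) order_facts(3,4) unfolding refl_on_def by blast
    then have lead: "lead_monomial ord (monom a - monom b) = a"
      using keys red(3) by (intro lead_monomial_eqI[OF order_facts(1)]) auto
    have "monom a - monom b \<noteq> 0"
      using keys by (metis keys_eq_empty insert_not_empty)
    then have "monom (lead_monomial ord (monom a - monom b)) \<in> initial_ideal V ord G"
      using self[OF gens] red(1) by blast
    then have "monom a \<in> initial_ideal V ord G"
      unfolding lead .
    from ideal_poly_ringD(3)[OF ideals[OF gens] this, of "monom w"] show "q \<in> initial_ideal V ord G"
      using red(4,5) p(3) by (simp add: add.commute)
  qed
  then have "initial_ideal V ord (toric_kernel V g) \<subseteq> initial_ideal V ord G"
    unfolding initial_ideal_def[of V ord "toric_kernel V g"]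
    by (rule ring.genideal_minimal[OF ring ideals[OF gens]])
  moreover have "initial_ideal V ord G \<subseteq> initial_ideal V ord (toric_kernel V g)"
    unfolding initial_ideal_def[of V ord G]
  proof (rule ring.genideal_minimal[OF ring ideals[OF order_refl]])
    show "?in G \<subseteq> initial_ideal V ord (toric_kernel V g)"
      using gens self[OF order_refl] by blast
  qed
  ultimately show ?thesis
    using assms gens by (auto simp: groebner_basis_def)
qed

end

section \<open>Sorted monomials of height-bounded sets\<close>

text \<open>The exponent vector of the image of the variable of \<open>B\<close>, a vertex of the
  base polytope.\<close>

definition vertex :: "nat set \<Rightarrow> nat mono" where
  "vertex B = (\<Sum>i\<in>B. Poly_Mapping.single i 1)"

lemma toric_map_conv: "toric_map = alg_map (\<lambda>B. monom (vertex B))"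
  by (simp add: toric_map_def vertex_def var_def prod_monom)

lemma lookup_vertex: "finite B \<Longrightarrow> Poly_Mapping.lookup (vertex B) i = of_bool (i \<in> B)"
  by (simp add: vertex_def lookup_sum lookup_single when_def of_bool_def)

lemma keys_vertex: "Poly_Mapping.keys (vertex B) \<subseteq> B"
proof -
  have "Poly_Mapping.keys (vertex B) \<subseteq> (\<Union>i\<in>B. Poly_Mapping.keys (Poly_Mapping.single i (1::nat)))"
    unfolding vertex_def by (rule keys_sum)
  also have "\<dots> \<subseteq> B"
    by simp
  finally show ?thesis .
qed

lemma vertex_swap:
  assumes "finite B" "i \<in> B" "j \<notin> B"
  shows "vertex (B - {i} \<union> {j}) + Poly_Mapping.single i 1 = vertex B + Poly_Mapping.single j 1"
proof -
  have "vertex B = Poly_Mapping.single i 1 + vertex (B - {i})"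
    unfolding vertex_def using assms by (intro sum.remove)
  moreover have "vertex (insert j (B - {i})) = Poly_Mapping.single j 1 + vertex (B - {i})"
    unfolding vertex_def using assms by (intro sum.insert) auto
  ultimately show ?thesis
    by (simp add: ac_simps)
qed

lemma toric_ideal_conv: "toric_ideal \<B> = toric_kernel \<B> vertex"
  by (auto simp: toric_ideal_def a_kernel_def' toric_kernel_def toric_map_conv)

text \<open>The target ring has variables from index 1 on, so the map lands in it once 0 lies in no
  base.\<close>

lemma ideal_toric_ideal:
  assumes "\<And>B. B \<in> \<B> \<Longrightarrow> 0 \<notin> B"
  shows "ideal (toric_ideal \<B>) (poly_ring \<B>)"
proof -
  have ring: "Ring.ring (poly_ring V)" for V :: "'v set"
    using cring_poly_ring cring.axioms(1) by blast
  have "ring_hom_ring (poly_ring \<B>) (poly_ring {1..}) toric_map"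
  proof (rule ring_hom_ringI[OF ring ring])
    fix p assume p: "p \<in> carrier (poly_ring \<B>)"
    have "vertex B \<in> monomials {1..}" if "B \<in> \<B>" for B
    proof -
      have "i \<ge> 1" if "i \<in> B" for i
        using assms[OF \<open>B \<in> \<B>\<close>] that by (cases i) auto
      then show ?thesis
        using keys_vertex[of B] by (auto simp: monomials_def)
    qed
    then have "mono_map vertex ` Poly_Mapping.keys p \<subseteq> monomials {1..}"
      using p mono_map_in_monomials[of _ \<B> vertex "{1..}"] by auto
    then show "toric_map p \<in> carrier (poly_ring {1..})"
      using keys_alg_map_monom[of vertex p] by (auto simp: toric_map_conv)
  next
    show "toric_map \<one>\<^bsub>poly_ring \<B>\<^esub> = \<one>\<^bsub>poly_ring {1..}\<^esub>"
      using alg_map_monom_monom[of vertex 0] by (simp add: toric_map_conv monom_0)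
  qed (simp_all add: toric_map_conv alg_map_monom_add alg_map_monom_mult)
  then show ?thesis
    unfolding toric_ideal_def by (rule ring_hom_ring.kernel_is_ideal)
qed

section \<open>Symmetric exchange binomials lie in the kernel\<close>

abbreviation pair_mono :: "'v \<Rightarrow> 'v \<Rightarrow> 'v mono" where
  "pair_mono v w \<equiv> Poly_Mapping.single v 1 + Poly_Mapping.single w 1"

lemma symmetric_exchange_binomials_conv:
  "symmetric_exchange_binomials \<B> =
    {monom (pair_mono B B') - monom (pair_mono C C') | B B' C C'. symmetric_exchange \<B> B B' C C'}"
  unfolding symmetric_exchange_binomials_def symmetric_exchange_def var_def monom_mult by blast

lemma finite_symmetric_exchange_binomials:
  assumes "finite \<B>"
  shows "finite (symmetric_exchange_binomials \<B>)"
proof (rule finite_subset)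
  show "symmetric_exchange_binomials \<B> \<subseteq>
    (\<lambda>(B, B', C, C'). monom (pair_mono B B') - monom (pair_mono C C')) ` (\<B> \<times> \<B> \<times> \<B> \<times> \<B>)"
    unfolding symmetric_exchange_binomials_conv symmetric_exchange_def by force
qed (use assms in simp)

lemma symmetric_exchange_binomials_subset:
  assumes "\<And>B. B \<in> \<B> \<Longrightarrow> finite B"
  shows "symmetric_exchange_binomials \<B> \<subseteq> toric_kernel \<B> vertex"
proof
  fix p assume "p \<in> symmetric_exchange_binomials \<B>"
  then obtain B B' C C' where p: "p = monom (pair_mono B B') - monom (pair_mono C C')"
    and ex: "symmetric_exchange \<B> B B' C C'"
    unfolding symmetric_exchange_binomials_conv by blast
  then obtain i j where ij: "i \<in> B - B'" "j \<in> B' - B" "C = B - {i} \<union> {j}" "C' = B' - {j} \<union> {i}"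
    and mem: "B \<in> \<B>" "B' \<in> \<B>" "C \<in> \<B>" "C' \<in> \<B>"
    unfolding symmetric_exchange_def by auto
  have "vertex C + Poly_Mapping.single i 1 = vertex B + Poly_Mapping.single j 1"
    "vertex C' + Poly_Mapping.single j 1 = vertex B' + Poly_Mapping.single i 1"
    unfolding ij(3,4) using assms[OF mem(1)] assms[OF mem(2)] ij(1,2) by (blast intro: vertex_swap)+
  \<comment> \<open>Adding the two swaps puts the same correction on both sides, which then
    cancels.\<close>
  then have "vertex C + vertex C' + (Poly_Mapping.single i 1 + Poly_Mapping.single j 1) =
      vertex B + vertex B' + (Poly_Mapping.single i 1 + Poly_Mapping.single j 1)"
    by (metis (no_types) add.commute add.left_commute)
  then have "vertex B + vertex B' = vertex C + vertex C'"
    by (metis add_right_imp_eq)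
  then have "mono_map vertex (pair_mono B B') = mono_map vertex (pair_mono C C')"
    by (simp only: mono_map_add mono_map_single)
  moreover have "pair_mono v w \<in> monomials \<B>" if "v \<in> \<B>" "w \<in> \<B>" for v w
    using that by (intro monomials_add) (simp_all add: monomials_def)
  ultimately show "p \<in> toric_kernel \<B> vertex"
    unfolding p using mem by (intro monom_diff_in_toric_kernel)
qed

text \<open>Shows that the sum of all height functions in a monomial depends only on its image: it
  is given by partial sums of the image exponents.\<close>

lemma weight_height_conv:
  assumes "\<And>B. B \<in> Poly_Mapping.keys m \<Longrightarrow> finite B"
  shows "weight (\<lambda>B. height B k) m = (\<Sum>i\<in>{1..k}. Poly_Mapping.lookup (mono_map vertex m) i)"
  unfolding lookup_mono_map weight_fun_sum[symmetric] height_conv_sum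
  by (intro weight_cong sum.cong refl) (simp add: lookup_vertex assms)

text \<open>For \<open>r = 0\<close> the only possible base is empty and its variable maps to 1, so
  the degree of a monomial would be lost; for positive \<open>r\<close> it is recoverable from the
  image.\<close>

locale bounded_sets_toric =
  fixes N r :: nat and lo hi :: "nat \<Rightarrow> nat"
  assumes r_pos: "r > 0"
begin

abbreviation bases :: "nat set set" where
  "bases \<equiv> bounded_sets N r lo hi"

text \<open>For bases with increasing elements b_1, b_2, ... and c_1, c_2, ...,
  \<open>interleaved\<close> says b_1 \<le> c_1 \<le> b_2 \<le> c_2 and so on; these are the sorted
  monomials of Sturmfels.\<close>

definition sorted_mono :: "nat set mono \<Rightarrow> bool" where
  "sorted_mono m \<longleftrightarrow>
    (\<forall>B\<in>Poly_Mapping.keys m. \<forall>B'\<in>Poly_Mapping.keys m. interleaved B B' \<or> interleaved B' B)"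

text \<open>The trailing indicator weights only break ties, so any enumeration of the bases
  serves.\<close>

definition order :: "nat set mono rel" where
  "order = weight_order bases (square_weight N # area_weight N r #
    map (\<lambda>B B'. of_bool (B' = B)) (SOME Bs. set Bs = bases))"

lemma finite_base: "B \<in> bases \<Longrightarrow> finite B"
  unfolding bounded_sets_def using finite_subset by blast

lemma zero_notin_base: "B \<in> bases \<Longrightarrow> 0 \<notin> B"
  by (auto simp: bounded_sets_def)

lemma monomial_order: "monomial_order bases order"
proof -
  have "set (SOME Bs. set Bs = bases) = bases"
    using finite_list[OF finite_bounded_sets] by (rule someI_ex)
  then show ?thesis
    unfolding order_def by (intro monomial_order_weight_order) auto
qed

lemma not_reducible_imp_sorted:
  assumes "m \<in> monomials bases"
    "\<not> reducible bases order (symmetric_exchange_binomials bases) m"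
  shows "sorted_mono m"
  unfolding sorted_mono_def
proof (intro ballI, rule ccontr)
  fix B B' assume keys: "B \<in> Poly_Mapping.keys m" "B' \<in> Poly_Mapping.keys m"
    and "\<not> (interleaved B B' \<or> interleaved B' B)"
  then have unsorted: "\<not> interleaved B B'" "\<not> interleaved B' B"
    by auto
  have mem: "B \<in> bases" "B' \<in> bases"
    using keys assms(1) by (auto simp: monomials_def)
  obtain C C' where ex: "symmetric_exchange bases B B' C C'"
    and less: "square_weight N C + square_weight N C' < square_weight N B + square_weight N B' \<or>
     square_weight N C + square_weight N C' = square_weight N B + square_weight N B' \<and>
     area_weight N r C + area_weight N r C' < area_weight N r B + area_weight N r B'"
    using exists_decreasing_exchange[OF mem unsorted] .
  have mem': "C \<in> bases" "C' \<in> bases"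
    using ex by (simp_all add: symmetric_exchange_def)
  have pairs: "pair_mono v w \<in> monomials bases" if "v \<in> bases" "w \<in> bases" for v w
    using that by (intro monomials_add) (simp_all add: monomials_def)
  have "(pair_mono C C', pair_mono B B') \<in> order"
    unfolding order_def weight_order_def using less pairs mem mem' by (auto simp: Cons_lenlex_iff)
  moreover have "pair_mono B B' \<noteq> pair_mono C C'"
  proof
    assume "pair_mono B B' = pair_mono C C'"
    then have "weight f (pair_mono B B') = weight f (pair_mono C C')" for f
      by simp
    from this[of "square_weight N"] this[of "area_weight N r"] less show False
      by simp
  qed
  moreover have "monom (pair_mono B B') - monom (pair_mono C C') \<in> symmetric_exchange_binomials bases"
    unfolding symmetric_exchange_binomials_conv using ex by blast
  moreover obtain w where "m = pair_mono B B' + w" "w \<in> monomials bases"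
  proof -
    obtain m1 where m1: "m = m1 + Poly_Mapping.single B 1" "Poly_Mapping.keys m1 \<subseteq> Poly_Mapping.keys m"
      using mono_split_var[OF keys(1)] .
    \<comment> \<open>Every set is interleaved with itself, so the unsorted pair is distinct and
      \<open>B'\<close> survives division by the variable of \<open>B\<close>.\<close>
    have "B \<noteq> B'"
      using unsorted by (auto simp: interleaved_def)
    then have "B' \<in> Poly_Mapping.keys m1"
      using keys(2) m1(1) by (simp add: in_keys_iff lookup_add lookup_single)
    then obtain m2 where m2: "m1 = m2 + Poly_Mapping.single B' 1"
      "Poly_Mapping.keys m2 \<subseteq> Poly_Mapping.keys m1"
      by (rule mono_split_var)
    show thesis
    proof
      show "m = pair_mono B B' + m2"
        unfolding m1(1) m2(1) by (simp only: ac_simps)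
      show "m2 \<in> monomials bases"
        using m1(2) m2(2) assms(1) by (auto simp: monomials_def)
    qed
  qed
  ultimately have "reducible bases order (symmetric_exchange_binomials bases) m"
    unfolding reducible_def by blast
  with assms(2) show False ..
qed

text \<open>A base of maximal area is on top: one lying above it everywhere can have no larger area,
  so the heights agree, and then both orders of interleaving hold.\<close>

lemma sorted_mono_top:
  assumes "m \<in> monomials bases" "sorted_mono m" "m \<noteq> 0"
  obtains B where "B \<in> Poly_Mapping.keys m" "\<And>B'. B' \<in> Poly_Mapping.keys m \<Longrightarrow> interleaved B B'"
proof -
  have nonempty: "Poly_Mapping.keys m \<noteq> {}"
    using assms(3) by simp
  obtain B where B: "B \<in> Poly_Mapping.keys m" "area N B = Max (area N ` Poly_Mapping.keys m)"
    using Max_in[of "area N ` Poly_Mapping.keys m"] nonempty by fastforce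
  have max: "area N B' \<le> area N B" if "B' \<in> Poly_Mapping.keys m" for B'
    unfolding B(2) using that by simp
  have "interleaved B B'" if B': "B' \<in> Poly_Mapping.keys m" for B'
  proof (cases "interleaved B' B")
    case True
    have "height B k = height B' k" for k
    proof (cases "k \<le> N")
      case False
      have "B \<in> bases" "B' \<in> bases"
        using B(1) B' assms(1) by (auto simp: monomials_def)
      then show ?thesis
        using False height_eq_card[of B N k] height_eq_card[of B' N k]
        by (simp add: bounded_sets_def)
    next
      case le: True
      show ?thesis
      proof (rule ccontr)
        assume "height B k \<noteq> height B' k"
        then have "height B k < height B' k"
          using True by (simp add: interleaved_def order_less_le)
        then have "area N B < area N B'"
          unfolding area_def using True le
          by (intro sum_strict_mono_ex1) (auto simp: interleaved_def)
        then show False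
          using max[OF B'] by simp
      qed
    qed
    then show ?thesis
      by (simp add: interleaved_def)
  next
    case False
    then show ?thesis
      using assms(2) B(1) B' by (auto simp: sorted_mono_def)
  qed
  then show thesis
    using that B(1) by blast
qed

text \<open>These place the top height in the half-open interval from T/K to T/K + 1, with T the
  total height at \<open>k\<close> and K the degree. The upper bound is strict because
  \<open>B\<close> itself is among the summands.\<close>

lemma top_height_bounds:
  assumes "B \<in> Poly_Mapping.keys m" "\<And>B'. B' \<in> Poly_Mapping.keys m \<Longrightarrow> interleaved B B'"
  shows "weight (\<lambda>B. height B k) m \<le> height B k * weight (\<lambda>_. 1) m"
    and "height B k * weight (\<lambda>_. 1) m < weight (\<lambda>B. height B k) m + weight (\<lambda>_. 1) m"
proof -
  show "weight (\<lambda>B. height B k) m \<le> height B k * weight (\<lambda>_. 1) m"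
    unfolding weight_const[of "height B k", symmetric] using assms(2)
    by (intro weight_mono) (simp add: interleaved_def)
  show "height B k * weight (\<lambda>_. 1) m < weight (\<lambda>B. height B k) m + weight (\<lambda>_. 1) m"
    unfolding weight_const[of "height B k", symmetric] weight_fun_add[symmetric]
    using assms by (intro weight_strict_mono[of _ _ _ B]) (auto simp: interleaved_def)
qed

text \<open>The top set of a sorted monomial of degree \<open>K\<close> has heights \<open>\<lceil>T k / K\<rceil>\<close>, where \<open>T\<close> is the
  sum of all height functions. Both \<open>T\<close> and \<open>K\<close> depend only on the image of the monomial.\<close>

lemma sorted_mono_unique:
  assumes "u \<in> monomials bases" "v \<in> monomials bases" "sorted_mono u" "sorted_mono v"
    "mono_map vertex u = mono_map vertex v"
  shows "u = v"
  using assms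
proof (induction "weight (\<lambda>_. 1) u" arbitrary: u v rule: less_induct)
  case less
  have fin: "finite B" if "B \<in> Poly_Mapping.keys m" "m \<in> monomials bases" for B m
    using that finite_base by (auto simp: monomials_def)
  have heights: "weight (\<lambda>B. height B k) u = weight (\<lambda>B. height B k) v" for k
    using weight_height_conv[where k = k, OF fin[OF _ less.prems(1)]]
      weight_height_conv[where k = k, OF fin[OF _ less.prems(2)]] less.prems(5) by simp
  \<comment> \<open>At \<open>N\<close> every base has height \<open>r\<close>, so the total height
    there determines the degree.\<close>
  have "weight (\<lambda>B. height B N) m = r * weight (\<lambda>_. 1) m" if "m \<in> monomials bases" for m
    unfolding weight_const[of r, symmetric]
    by (rule weight_cong) (use that height_eq_card[OF _ order_refl] in
      \<open>auto simp: monomials_def bounded_sets_def\<close>)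
  then have deg: "weight (\<lambda>_. 1) u = weight (\<lambda>_. 1) v"
    using heights[of N] r_pos less.prems(1,2) by simp
  have pos: "weight (\<lambda>_. 1) m > 0 \<longleftrightarrow> m \<noteq> 0" for m :: "nat set mono"
    using weight_strict_mono[of m "\<lambda>_. 0" "\<lambda>_. 1"] weight_const[of 0 m]
    by (metis all_not_in_conv keys_eq_empty le0 less_irrefl mult_0 weight_0 zero_less_one)
  show ?case
  proof (cases "u = 0")
    case True
    then show ?thesis
      using pos[of u] pos[of v] deg by auto
  next
    case False
    then have K: "weight (\<lambda>_. 1) u > 0" "v \<noteq> 0"
      using pos[of u] pos[of v] deg by auto
    obtain B where B: "B \<in> Poly_Mapping.keys u" "\<And>B'. B' \<in> Poly_Mapping.keys u \<Longrightarrow> interleaved B B'"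
      using sorted_mono_top[OF less.prems(1,3) False] by blast
    obtain C where C: "C \<in> Poly_Mapping.keys v" "\<And>B'. B' \<in> Poly_Mapping.keys v \<Longrightarrow> interleaved C B'"
      using sorted_mono_top[OF less.prems(2,4) K(2)] by blast
    \<comment> \<open>From x - 1 < T/K \<le> y follows x \<le> y; used both ways, it makes the two
      top heights equal.\<close>
    have squeeze: "x \<le> y" if "x * K < T + K" "T \<le> y * K" for x y T K :: nat
    proof -
      have "x * K < Suc y * K"
        using that by simp
      then show ?thesis
        by (metis less_Suc_eq_le mult_less_cancel2)
    qed
    have "height B = height C"
    proof
      fix k
      show "height B k = height C k"
      proof (rule le_antisym)
        show "height B k \<le> height C k"
          using squeeze[OF top_height_bounds(2)[OF B]] top_height_bounds(1)[OF C, of k] heights[of k] deg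
          by simp
        show "height C k \<le> height B k"
          using squeeze[OF top_height_bounds(2)[OF C]] top_height_bounds(1)[OF B, of k] heights[of k] deg
          by simp
      qed
    qed
    moreover have "0 \<notin> B" "0 \<notin> C"
      using B(1) C(1) less.prems(1,2) zero_notin_base by (auto simp: monomials_def)
    ultimately have "B = C"
      using set_eq_if_height_eq by blast
    \<comment> \<open>The common top base is divided out; sortedness survives because the support
      can only shrink.\<close>
    obtain u' where u': "u = u' + Poly_Mapping.single B 1" "Poly_Mapping.keys u' \<subseteq> Poly_Mapping.keys u"
      using mono_split_var[OF B(1)] .
    obtain v' where v': "v = v' + Poly_Mapping.single B 1" "Poly_Mapping.keys v' \<subseteq> Poly_Mapping.keys v"
      using mono_split_var[OF C(1)] unfolding \<open>B = C\<close> .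
    have "u' = v'"
    proof (rule less.hyps)
      show "weight (\<lambda>_. 1) u' < weight (\<lambda>_. 1) u"
        unfolding u'(1) by simp
      show "mono_map vertex u' = mono_map vertex v'"
        using less.prems(5) unfolding u'(1) v'(1) mono_map_add by (rule add_right_imp_eq)
    qed (use less.prems(1-4) u'(2) v'(2) in \<open>unfold monomials_def sorted_mono_def, blast+\<close>)
    then show ?thesis
      using u'(1) v'(1) by simp
  qed
qed

sublocale unique_normal_forms bases order vertex "symmetric_exchange_binomials bases"
proof (rule unique_normal_forms.intro)
  show "monomial_order bases order"
    by (rule monomial_order)
  show "ideal (toric_kernel bases vertex) (poly_ring bases)"
    unfolding toric_ideal_conv[symmetric]
    by (rule ideal_toric_ideal) (rule zero_notin_base)
  show "symmetric_exchange_binomials bases \<subseteq> toric_kernel bases vertex"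
    by (rule symmetric_exchange_binomials_subset) (rule finite_base)
  show "u = v" if "u \<in> monomials bases" "v \<in> monomials bases"
    "mono_map vertex u = mono_map vertex v"
    "\<not> reducible bases order (symmetric_exchange_binomials bases) u"
    "\<not> reducible bases order (symmetric_exchange_binomials bases) v" for u v
    using that by (intro sorted_mono_unique not_reducible_imp_sorted)
qed

end

theorem theorem4p1:
  fixes n r :: nat and \<alpha> \<omega> :: "step list" and \<M> :: "nat set set"
  assumes "n > 0" and "r > 0"
    and "lattice_path n r \<alpha>" and "lattice_path n r \<omega>" and "weakly_above n \<alpha> \<omega>"
    and "\<M> = lattice_path_matroid n r \<alpha> \<omega>"
  shows "toric_ideal \<M> = Idl\<^bsub>base_ring \<M>\<^esub> (symmetric_exchange_binomials \<M>) \<and>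
    (\<exists>ord. monomial_order \<M> ord \<and>
      groebner_basis \<M> ord (symmetric_exchange_binomials \<M>) (toric_ideal \<M>))"
proof -
  interpret bounded_sets_toric "n + r" r "height (north_set \<omega>)" "height (north_set \<alpha>)"
    by unfold_locales (rule assms(2))
  have "\<M> = bases"
    using lattice_path_matroid_eq[OF assms(3,4)] assms(6) by simp
  then show ?thesis
    using toric_kernel_eq_genideal monomial_order
      groebner_basis_toric_kernel[OF finite_symmetric_exchange_binomials[OF finite_bounded_sets]]
    unfolding toric_ideal_conv by blast
qed

end
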